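(* Let $P(x,y)\in\mathbb{C}[x,y]$ be a polynomial of degree $g\ge 1$ in $y$. If $P(x,y)$ does not vanish on the unit torus $\{(x,y)\in\mathbb{C}^2: |x|=|y|=1\}$, then $$\lim_{n\to\infty}c(P(x,x^n))=c(P(x,y)).$$
   Context: For a univariate polynomial $Q\in\mathbb{C}[x]$ of degree $d\ge 1$ with no zeros on the unit circle, $$c(Q):=\frac1d\int_0^1\frac{Q'(e^{2\pi i t})e^{2\pi i t}}{Q(e^{2\pi i t})}\,dt,$$ which equals the number of zeros of $Q$ (with multiplicity) in the open unit disc divided by $d$. For a bivariate polynomial $P(x,y)$ of degree $g\ge1$ in $y$ with no zeros on the unit torus, $$c(P(x,y)):=\frac{1}{g}\int_0^1\int_0^1\frac{\frac{\partial P}{\partial y}(e^{2\pi i t},e^{2\pi i s})\,e^{2\pi i s}}{P(e^{2\pi i t},e^{2\pi i s})}\,dt\,ds.$$ In $c(P(x,x^n))$, $P(x,x^n)$ is regarded as a univariate polynomial in $x$. *)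

theory Defs
  imports "HOL-Analysis.Analysis" "HOL-Computational_Algebra.Polynomial"
begin

(* A polynomial P(x,y) is an element of (C[x])[y], that is, of type complex poly poly:
   the outer variable is y and the coefficients are polynomials in x. Hence degree P is
   the degree in y and pderiv P is the partial derivative with respect to y. *)

definition eval2 :: "complex poly poly \<Rightarrow> complex \<Rightarrow> complex \<Rightarrow> complex" where
  "eval2 P x y = poly (poly P [:y:]) x"

lemma eval2_altdef: "eval2 P x y = (\<Sum>i\<le>degree P. poly (coeff P i) x * y ^ i)"
  by (simp add: eval2_def poly_altdef [of P] poly_sum)

definition subst_power :: "complex poly poly \<Rightarrow> nat \<Rightarrow> complex poly" where
  "subst_power P n = poly P (monom 1 n)"

lemma poly_subst_power: "poly (subst_power P n) x = eval2 P x (x ^ n)"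
  by (simp add: subst_power_def eval2_altdef poly_altdef [of P] poly_sum poly_monom)

(* c(Q); meaningful when degree Q >= 1 and Q has no zeros on the unit circle.
   Recall cis (2 * pi * t) = e^(2 pi i t). *)
definition c_uni :: "complex poly \<Rightarrow> complex" where
  "c_uni Q = 1 / of_nat (degree Q) *
     integral {0..1::real} (\<lambda>t.
       poly (pderiv Q) (cis (2 * pi * t)) * cis (2 * pi * t) / poly Q (cis (2 * pi * t)))"

(* c(P(x,y)); meaningful when degree P >= 1 and P has no zeros on the unit torus. *)
definition c_biv :: "complex poly poly \<Rightarrow> complex" where
  "c_biv P = 1 / of_nat (degree P) *
     integral {0..1::real} (\<lambda>s. integral {0..1::real} (\<lambda>t.
       eval2 (pderiv P) (cis (2 * pi * t)) (cis (2 * pi * s)) * cis (2 * pi * s)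
         / eval2 P (cis (2 * pi * t)) (cis (2 * pi * s))))"

end

theory Submission
  imports Defs "HOL-Real_Asymp.Real_Asymp"
begin

text \<open>
  Write \<open>Q\<^sub>n(x) = P(x, x\<^sup>n)\<close>. By the chain rule
  \<open>x Q\<^sub>n'(x) = x P\<^sub>x(x, x\<^sup>n) + n x\<^sup>n P\<^sub>y(x, x\<^sup>n)\<close>, and \<open>Q\<^sub>n\<close> has degree \<open>g n + m\<close> for large \<open>n\<close>,
  where \<open>m\<close> is the degree of the leading coefficient of \<open>P\<close> as a polynomial in \<open>y\<close>. After division
  by \<open>Q\<^sub>n\<close> the first summand stays bounded on the circle, so its contribution vanishes in the limit.
  The second one is governed by the equidistribution of the curves \<open>(t, n t)\<close> on the torus: cutting
  \<open>[0,1]\<close> into \<open>n\<close> pieces and substituting \<open>t = (k + s)/n\<close> gives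
  \<open>\<integral> H(t, n t) dt = \<integral> 1/n \<Sum>\<^sub>k H((k + s)/n, s) ds\<close> for \<open>H\<close> periodic in its second argument, and
  the Riemann sums converge to \<open>\<integral> H(t, s) dt\<close> uniformly in \<open>s\<close>.
\<close>

section \<open>Integrals along the curves \<open>(t, n t)\<close>\<close>

lemma integral_unit_interval_subdivide:
  fixes f :: "real \<Rightarrow> 'a::banach"
  assumes cont: "continuous_on {0..1} f" and n: "n > 0"
  shows "integral {0..1} f = (\<Sum>k<n. integral {0..1} (\<lambda>t. f ((real k + t) / real n))) /\<^sub>R real n"
proof -
  have piece: "integral {real k / n..real (Suc k) / n} f =
      integral {0..1} (\<lambda>t. f ((real k + t) / real n)) /\<^sub>R real n" if "k < n" for k
  proof -
    have sub: "{real k / n..real (Suc k) / n} \<subseteq> {0..1}"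
      using that n by (auto simp: field_simps intro: order_trans)
    have "(f has_integral integral {real k / n..real (Suc k) / n} f)
        (cbox (real k / n) (real (Suc k) / n))"
      using integrable_continuous_real[OF continuous_on_subset[OF cont sub]]
      by (simp add: integrable_integral)
    from has_integral_affinity'[OF this, of "1 / real n" "real k / n"] n
    have "((\<lambda>t. f ((real k + t) / real n)) has_integral
        real n *\<^sub>R integral {real k / n..real (Suc k) / n} f) {0..1}"
      by (simp add: add_divide_distrib add.commute diff_divide_distrib)
    then show ?thesis
      using n by (simp add: integral_unique)
  qed
  have "integral {0..real m / n} f =
      (\<Sum>k<m. integral {0..1} (\<lambda>t. f ((real k + t) / real n)) /\<^sub>R real n)" if "m \<le> n" for m
    using that
  proof (induction m)
    case (Suc m)
    have "{0..real (Suc m) / n} \<subseteq> {0..1}"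
      using Suc.prems n by (auto simp: field_simps intro: order_trans)
    then have "f integrable_on {0..real (Suc m) / n}"
      by (intro integrable_continuous_real continuous_on_subset[OF cont])
    then have "integral {0..real (Suc m) / n} f =
        integral {0..real m / n} f + integral {real m / n..real (Suc m) / n} f"
      by (intro Henstock_Kurzweil_Integration.integral_combine[symmetric]) (auto simp: divide_right_mono)
    with Suc piece[of m] show ?case
      by simp
  qed simp
  from this[of n] n show ?thesis
    by (simp add: scaleR_sum_right)
qed

text \<open>Both integrals are cut into the same \<open>n\<close> pieces, so their difference is an
  average of \<open>n\<close> terms, each controlled by the oscillation of \<open>H\<close> in its
  first argument over a length of at most \<open>1/n\<close>.\<close>

lemma integral_curve_tendsto:
  fixes H :: "real \<times> real \<Rightarrow> 'a::banach"
  assumes cont: "continuous_on UNIV H"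
    and per: "\<And>t s. H (t, s + 1) = H (t, s)"
  shows "(\<lambda>n. integral {0..1} (\<lambda>t. H (t, real n * t)))
    \<longlonglongrightarrow> integral {0..1} (\<lambda>s. integral {0..1} (\<lambda>t. H (t, s)))"
proof (rule LIMSEQ_I)
  fix r :: real assume "r > 0"
  define e where "e = r / 2"
  have e: "0 < e" "e < r" using \<open>r > 0\<close> by (auto simp: e_def)
  have per': "H (t, real k + s) = H (t, s)" for t s k
  proof (induction k)
    case (Suc k)
    then show ?case using per[of t "real k + s"] by (simp add: add_ac)
  qed simp
  note contI = continuous_on_compose2[OF cont]
  \<comment> \<open>The unit square suffices: once integer shifts are removed by periodicity, every
    point compared below lies in it.\<close>
  have "uniformly_continuous_on ({0..1} \<times> {0..1}) H"
    by (intro compact_uniformly_continuous compact_Times continuous_on_subset[OF cont]) auto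
  then obtain d where d: "d > 0"
    "\<And>p q. p \<in> {0..1} \<times> {0..1} \<Longrightarrow> q \<in> {0..1} \<times> {0..1} \<Longrightarrow> dist p q < d \<Longrightarrow> dist (H p) (H q) < e"
    using e(1) unfolding uniformly_continuous_on_def by metis
  obtain N where N: "N > 0" "1 / real N < d"
    using d(1) nat_approx_posE[of d] by (metis zero_less_Suc)
  have "norm (integral {0..1} (\<lambda>t. H (t, real n * t))
      - integral {0..1} (\<lambda>s. integral {0..1} (\<lambda>t. H (t, s)))) < r" if "n \<ge> N" for n
  proof -
    have n: "n > 0" "1 / real n < d"
    proof -
      show "n > 0" using N that by simp
      have "1 / real n \<le> 1 / real N" using N that by (simp add: frac_le)
      then show "1 / real n < d" using N by simp
    qed
    \<comment> \<open>\<open>K k\<close> is the integrand on the \<open>k\<close>-th piece of the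
      curve, with the shift by \<open>k\<close> dropped; \<open>J k\<close> freezes the second
      argument and averages over the same piece.\<close>
    define K where "K k s = H ((real k + s) / n, s)" for k s
    define J where "J k s = integral {0..1} (\<lambda>t. H ((real k + t) / n, s))" for k s
    have intK: "K k integrable_on {0..1}" for k
      unfolding K_def by (intro integrable_continuous_real contI continuous_intros) (use n in auto)
    have intJ: "J k integrable_on {0..1}" for k
    proof -
      have "continuous_on (cbox 0 1) (\<lambda>s. integral (cbox 0 1) (\<lambda>t. H ((real k + t) / n, s)))"
        by (intro integral_continuous_on_param)
           (use n in \<open>auto simp: split_beta intro!: contI continuous_intros\<close>)
      then show ?thesis
        unfolding J_def by (intro integrable_continuous_real) simp
    qed
    have "integral {0..1} (\<lambda>t. H (t, real n * t)) =
        (\<Sum>k<n. integral {0..1} (\<lambda>t. H ((real k + t) / n, real k + t))) /\<^sub>R n"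
      using n by (subst integral_unit_interval_subdivide[OF _ n(1)])
        (auto intro!: contI continuous_intros)
    then have A: "integral {0..1} (\<lambda>t. H (t, real n * t)) = (\<Sum>k<n. integral {0..1} (K k)) /\<^sub>R n"
      by (simp add: per' K_def[abs_def])
    have "integral {0..1} (\<lambda>t. H (t, s)) = (\<Sum>k<n. J k s) /\<^sub>R n" for s
      unfolding J_def by (intro integral_unit_interval_subdivide[OF _ n(1)] contI continuous_intros) auto
    then have B: "integral {0..1} (\<lambda>s. integral {0..1} (\<lambda>t. H (t, s)))
        = (\<Sum>k<n. integral {0..1} (J k)) /\<^sub>R n"
      by (simp add: integral_sum intJ)
    have close: "norm (K k s - J k s) \<le> e" if "k < n" "s \<in> {0..1}" for k s
    proof -
      have int: "(\<lambda>t. H ((real k + t) / n, s)) integrable_on {0..1}"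
        by (intro integrable_continuous_real contI continuous_intros) (use n in auto)
      have in01: "(real k + t) / n \<in> {0..1}" if "t \<in> {0..1}" for t
        using that \<open>k < n\<close> n by (auto simp: field_simps)
      have "K k s - J k s = integral {0..1} (\<lambda>t. K k s - H ((real k + t) / n, s))"
        unfolding J_def by (subst integral_diff[OF _ int]) auto
      also have "norm \<dots> \<le> e * (1 - 0)"
      proof (rule integral_bound)
        show "continuous_on {0..1} (\<lambda>t. K k s - H ((real k + t) / n, s))"
          by (intro contI continuous_intros) (use n in auto)
        fix t :: real assume t: "t \<in> {0..1}"
        have "\<bar>s - t\<bar> \<le> 1" using t that by auto
        then have "\<bar>s - t\<bar> / n < d"
          using n by (smt (verit) divide_right_mono of_nat_0_le_iff)
        \<comment> \<open>The two points share their second coordinate, so only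
          \<open>\<bar>s - t\<bar> / n\<close> counts.\<close>
        then have "dist ((real k + s) / n, s) ((real k + t) / n, s) < d"
          using n by (simp add: dist_Pair_Pair dist_real_def diff_divide_distrib[symmetric] abs_divide)
        then show "norm (K k s - H ((real k + t) / n, s)) \<le> e"
          using d(2)[of "((real k + s) / n, s)" "((real k + t) / n, s)"] in01 t that
          by (simp add: K_def dist_norm)
      qed simp
      finally show ?thesis by simp
    qed
    have "norm (integral {0..1} (K k) - integral {0..1} (J k)) \<le> e" if "k < n" for k
    proof -
      have "norm (integral {0..1} (\<lambda>s. K k s - J k s)) \<le> integral {0..1} (\<lambda>s::real. e)"
        using close[OF that] intK intJ by (intro integral_norm_bound_integral integrable_diff) auto
      then show ?thesis
        using intK intJ by (simp add: integral_diff)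
    qed
    then have "norm (\<Sum>k<n. integral {0..1} (K k) - integral {0..1} (J k)) \<le> real (card {..<n}) * e"
      by (intro sum_norm_bound) auto
    then have "norm ((\<Sum>k<n. integral {0..1} (K k) - integral {0..1} (J k)) /\<^sub>R n) \<le> e"
      using n by (simp add: field_simps)
    then show ?thesis
      using e unfolding A B by (simp add: sum_subtractf scaleR_diff_right)
  qed
  then show "\<exists>N. \<forall>n\<ge>N. norm (integral {0..1} (\<lambda>t. H (t, real n * t))
      - integral {0..1} (\<lambda>s. integral {0..1} (\<lambda>t. H (t, s)))) < r"
    by blast
qed

section \<open>Derivative and degree of \<open>P(x, x^n)\<close>\<close>

lemma continuous_on_eval2 [continuous_intros]:
  assumes "continuous_on S f" "continuous_on S g"
  shows "continuous_on S (\<lambda>z. eval2 P (f z) (g z))"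
  unfolding eval2_altdef by (intro continuous_intros assms)

text \<open>The chain rule, with \<open>map_poly pderiv P\<close> as the partial derivative in the
  inner variable; the induction step is the product rule.\<close>

lemma pderiv_poly_poly:
  fixes P :: "'a::idom poly poly"
  shows "pderiv (poly P q) = poly (map_poly pderiv P) q + poly (pderiv P) q * pderiv q"
  by (induction P)
     (auto simp: map_poly_pCons pderiv_add pderiv_mult pderiv_pCons algebra_simps)

text \<open>The factor \<open>x\<close> turns \<open>n x^(n-1)\<close> into \<open>n x^n\<close>, so
  the second summand contains the integrand of \<open>c_biv\<close> and \<open>n = 0\<close> needs
  no exception.\<close>

lemma poly_pderiv_subst_power:
  "poly (pderiv (subst_power P n)) x * x =
     eval2 (map_poly pderiv P) x (x ^ n) * x + of_nat n * (eval2 (pderiv P) x (x ^ n) * x ^ n)"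
proof -
  have "poly (pderiv (monom 1 n)) x * x = of_nat n * x ^ n"
    by (cases n) (auto simp: pderiv_monom poly_monom)
  then show ?thesis
    unfolding subst_power_def pderiv_poly_poly
    using poly_subst_power[of "map_poly pderiv P" n x] poly_subst_power[of "pderiv P" n x]
    by (simp add: subst_power_def ring_distribs mult_ac)
qed

text \<open>For such \<open>n\<close> the blocks \<open>coeff P i * x^(i n)\<close> occupy disjoint
  ranges of exponents, so nothing cancels and the last block decides the degree.\<close>

lemma degree_subst_power:
  assumes "P \<noteq> 0" "\<And>i. degree (coeff P i) < n"
  shows "degree (subst_power P n) = degree P * n + degree (lead_coeff P)"
proof -
  \<comment> \<open>Nonvanishing is carried through the induction because degrees add only for
    products of nonzero factors.\<close>
  have "subst_power P n \<noteq> 0 \<and> degree (subst_power P n) = degree P * n + degree (lead_coeff P)"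
    using assms
  proof (induction P)
    case (pCons a p)
    show ?case
    proof (cases "p = 0")
      case True
      with pCons.hyps show ?thesis by (simp add: subst_power_def)
    next
      case False
      have "degree (coeff p i) < n" for i
        using pCons.prems(2)[of "Suc i"] by simp
      with pCons.IH False have nz: "subst_power p n \<noteq> 0"
        and IH: "degree (subst_power p n) = degree p * n + degree (lead_coeff p)"
        by blast+
      have "degree (monom 1 n * subst_power p n) = n + degree (subst_power p n)"
        using nz by (subst degree_mult_eq) (auto simp: degree_monom_eq monom_eq_0_iff)
      moreover have a: "degree a < n" using pCons.prems(2)[of 0] by simp
      ultimately have "degree (a + monom 1 n * subst_power p n) = n + degree (subst_power p n)"
        by (subst degree_add_eq_right) auto
      moreover have "subst_power (pCons a p) n = a + monom 1 n * subst_power p n"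
        by (simp add: subst_power_def)
      ultimately have "degree (subst_power (pCons a p) n) = n + degree (subst_power p n)"
        by simp
      with a IH False show ?thesis by auto
    qed
  qed simp
  then show ?thesis ..
qed

section \<open>Passage to the limit\<close>

theorem corollary2p4:
  fixes P :: "complex poly poly"
  assumes "degree P \<ge> 1"
    and "\<And>x y. cmod x = 1 \<Longrightarrow> cmod y = 1 \<Longrightarrow> eval2 P x y \<noteq> 0"
  shows "(\<lambda>n. c_uni (subst_power P n)) \<longlonglongrightarrow> c_biv P"
proof -
  note nz = assms(2)
  define e where "e t = cis (2 * pi * t)" for t
  have norm_e [simp]: "cmod (e t) = 1" for t by (simp add: e_def)
  have e_power: "e t ^ n = e (real n * t)" for t n
    by (simp add: e_def Complex.DeMoivre mult_ac)
  have e_cont [continuous_intros]: "continuous_on S (\<lambda>z. e (f z))"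
    if "continuous_on S f" for S :: "'b::topological_space set" and f
    unfolding e_def by (intro continuous_intros that)
  define H where "H = (\<lambda>(t, s). eval2 (pderiv P) (e t) (e s) * e s / eval2 P (e t) (e s))"
  define R where "R x y = eval2 (map_poly pderiv P) x y * x / eval2 P x y" for x y
  \<comment> \<open>For large \<open>n\<close>, \<open>c_uni (subst_power P n)\<close> will be
    \<open>(E n + n * A n) / (g * n + m)\<close>.\<close>
  define A where "A n = integral {0..1} (\<lambda>t. H (t, real n * t))" for n
  define E where "E n = integral {0..1} (\<lambda>t. R (e t) (e (real n * t)))" for n
  define g where "g = degree P"
  define m where "m = degree (lead_coeff P)"
  have g: "g > 0" using assms(1) by (simp add: g_def)

  have H_cont: "continuous_on UNIV H"
    unfolding H_def split_beta by (intro continuous_intros) (auto simp: nz)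
  have "H (t, s + 1) = H (t, s)" for t s
  proof -
    have "e (s + 1) = e s" by (simp add: e_def ring_distribs flip: cis_mult)
    then show ?thesis by (simp add: H_def)
  qed
  then have "A \<longlonglongrightarrow> integral {0..1} (\<lambda>s. integral {0..1} (\<lambda>t. H (t, s)))"
    unfolding A_def by (intro integral_curve_tendsto H_cont)
  moreover have "(\<lambda>n. of_nat n / of_nat (g * n + m) :: complex) \<longlonglongrightarrow> 1 / of_nat g"
  proof -
    have "(\<lambda>n. real n / real (g * n + m)) \<longlonglongrightarrow> 1 / real g"
      using g by (real_asymp simp: inverse_eq_divide)
    from tendsto_of_real[OF this, where 'a = complex] show ?thesis by simp
  qed
  moreover have "c_biv P = 1 / of_nat g * integral {0..1} (\<lambda>s. integral {0..1} (\<lambda>t. H (t, s)))"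
    by (simp add: c_biv_def g_def H_def e_def)
  ultimately have main: "(\<lambda>n. of_nat n / of_nat (g * n + m) * A n) \<longlonglongrightarrow> c_biv P"
    by (simp only: tendsto_mult)

  \<comment> \<open>Every curve stays on the compact torus, so one bound \<open>B\<close> for
    \<open>R\<close> serves all \<open>n\<close>.\<close>
  have R_cont: "continuous_on (sphere 0 1 \<times> sphere 0 1) (\<lambda>z. R (fst z) (snd z))"
    unfolding R_def by (intro continuous_intros) (auto simp: nz)
  then have "bounded ((\<lambda>z. R (fst z) (snd z)) ` (sphere 0 1 \<times> sphere 0 1))"
    by (intro compact_imp_bounded compact_continuous_image compact_Times compact_sphere)
  then obtain B where B: "\<And>x y. cmod x = 1 \<Longrightarrow> cmod y = 1 \<Longrightarrow> cmod (R x y) \<le> B"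
    unfolding bounded_iff by fastforce
  have R_curve: "continuous_on {0..1} (\<lambda>t. R (e t) (e (real n * t)))" for n
    unfolding R_def by (intro continuous_intros) (auto simp: nz)
  have "cmod (E n) \<le> B" for n
    using integral_bound[OF _ R_curve[of n], of B] B by (simp add: E_def)
  then have "Bseq E" by (rule BseqI')
  moreover have "Zfun (\<lambda>n. 1 / of_nat (g * n + m) :: complex) sequentially"
  proof -
    have "(\<lambda>n. 1 / real (g * n + m)) \<longlonglongrightarrow> 0"
      using g by real_asymp
    from tendsto_of_real[OF this, where 'a = complex] show ?thesis by (simp add: tendsto_Zfun_iff)
  qed
  ultimately have "Zfun (\<lambda>n. 1 / of_nat (g * n + m) * E n) sequentially"
    by (intro bounded_bilinear.Zfun_prod_Bfun[OF bounded_bilinear_mult])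
  then have "(\<lambda>n. 1 / of_nat (g * n + m) * E n) \<longlonglongrightarrow> 0"
    by (simp add: tendsto_Zfun_iff)
  from tendsto_add[OF this main]
  have lim: "(\<lambda>n. 1 / of_nat (g * n + m) * E n + of_nat n / of_nat (g * n + m) * A n) \<longlonglongrightarrow> c_biv P"
    by simp

  \<comment> \<open>Finitely many conditions hold eventually together. Coefficients beyond
    \<open>g\<close> are zero, of degree 0, and \<open>0 < n\<close> follows from any one of the
    conditions.\<close>
  have "\<forall>\<^sub>F n in sequentially. \<forall>i\<in>{..g}. degree (coeff P i) < n"
    by (intro eventually_ball_finite) (auto intro: eventually_gt_at_top)
  then have "\<forall>\<^sub>F n in sequentially.
      1 / of_nat (g * n + m) * E n + of_nat n / of_nat (g * n + m) * A n = c_uni (subst_power P n)"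
  proof eventually_elim
    case (elim n)
    have "degree (coeff P i) < n" for i
    proof (cases "i \<le> g")
      case False
      then have "coeff P i = 0" by (simp add: g_def coeff_eq_0)
      moreover have "0 < n" using elim by force
      ultimately show ?thesis by simp
    qed (use elim in auto)
    then have deg: "degree (subst_power P n) = g * n + m"
      unfolding g_def m_def using assms(1) by (intro degree_subst_power) auto
    have "poly (pderiv (subst_power P n)) (e t) * e t / poly (subst_power P n) (e t)
        = R (e t) (e (real n * t)) + of_nat n * H (t, real n * t)" for t
      by (simp add: poly_pderiv_subst_power poly_subst_power e_power R_def H_def add_divide_distrib)
    moreover have "(\<lambda>t. H (t, real n * t)) integrable_on {0..1}"
      by (intro integrable_continuous_real continuous_on_compose2[OF H_cont] continuous_intros) auto
    ultimately have "integral {0..1}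
        (\<lambda>t. poly (pderiv (subst_power P n)) (e t) * e t / poly (subst_power P n) (e t))
        = E n + of_nat n * A n"
      using integrable_continuous_real[OF R_curve]
      by (simp add: E_def A_def integral_add integrable_on_mult_right)
    then show ?case
      unfolding c_uni_def deg by (simp add: e_def ring_distribs)
  qed
  with lim show ?thesis
    by (rule Lim_transform_eventually)
qed

end
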